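(* Let $m>0$ and consider the curved 4-body problem of curvature $\kappa\neq0$ with masses $m_1=m_2=m$ and $m_3=m_4=0$. For $r>0$ and $\alpha\in\mathbb R\setminus\{0\}$ consider the rotating square configuration, with $m_1,m_2$ at the opposite ends of one diagonal and $m_3,m_4$ at the opposite ends of the other diagonal, inscribed in a circle of radius $r$ parallel with the $xy$-plane: $$(x_1,y_1)=(r\cos\alpha t,\ r\sin\alpha t),\qquad (x_2,y_2)=(-r\cos\alpha t,\ -r\sin\alpha t),$$ $$(x_3,y_3)=(-r\sin\alpha t,\ r\cos\alpha t),\qquad (x_4,y_4)=(r\sin\alpha t,\ -r\cos\alpha t).$$ (i) If $\kappa>0$ (motion on $\mathbb S_\kappa^2$), then there exist $r$ with $0<r<\kappa^{-1/2}$ and $\alpha\neq0$ such that this configuration is a solution of the equations of motion (a square relative equilibrium). (ii) If $\kappa<0$ (motion on $\mathbb H_\kappa^2$), then for no $r>0$ and no $\alpha\neq 0$ is this configuration a solution of the equations of motion.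
   Context: The surfaces are $\mathbb S_\kappa^2=\{(x,y,z)\in\mathbb R^3:\kappa(x^2+y^2+z^2)+2\kappa^{1/2}z=0\}$ for $\kappa>0$ and $\mathbb H_\kappa^2=\{(x,y,z)\in\mathbb R^3:\kappa(x^2+y^2-z^2)+2|\kappa|^{1/2}z=0,\ z\ge0\}$ for $\kappa<0$. Points are described by their coordinates $(x,y)$, with $\kappa(x^2+y^2)<1$, the height being $z=|\kappa|^{-1/2}\big[\sqrt{1-\kappa(x^2+y^2)}-1\big]$; so a circle $x^2+y^2=r^2$ (with $r<\kappa^{-1/2}$ if $\kappa>0$) corresponds to a circle of radius $r$ on the surface parallel with the $xy$-plane. The equations of motion of the curved 4-body problem with masses $m_1,\dots,m_4\ge 0$ in these coordinates are, for $i=1,2,3,4$, $$\ddot x_i=\sum_{j=1,\,j\ne i}^4\frac{m_j\Big[x_j-\Big(1-\frac{\kappa\rho_{ij}^2}{2}\Big)x_i\Big]}{\Big(1-\frac{\kappa\rho_{ij}^2}{4}\Big)^{3/2}\rho_{ij}^3}-\kappa(\dot x_i^2+\dot y_i^2+\kappa B_i)x_i,$$ $$\ddot y_i=\sum_{j=1,\,j\ne i}^4\frac{m_j\Big[y_j-\Big(1-\frac{\kappa\rho_{ij}^2}{2}\Big)y_i\Big]}{\Big(1-\frac{\kappa\rho_{ij}^2}{4}\Big)^{3/2}\rho_{ij}^3}-\kappa(\dot x_i^2+\dot y_i^2+\kappa B_i)y_i,$$ where $A_i=x_i^2+y_i^2$, $\ B_i=\dfrac{(x_i\dot x_i+y_i\dot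 y_i)^2}{1-\kappa(x_i^2+y_i^2)}$, and $\rho_{ij}>0$ is given by $$\rho_{ij}^2=(x_i-x_j)^2+(y_i-y_j)^2+\frac{\kappa(A_i-A_j)^2}{\big(\sqrt{1-\kappa A_i}+\sqrt{1-\kappa A_j}\big)^2}.$$ A negligible mass is a mass set equal to $0$ in these equations: it exerts no force but moves under the attraction of the others. A relative equilibrium is a solution whose mutual distances are constant in time; here all bodies rotate with the same constant angular velocity $\alpha\ne0$. *)

theory Defs
  imports "HOL-Analysis.Analysis"
begin

text \<open>
  Bodies are indexed by \<open>1, 2, 3, 4\<close>. A configuration at one instant is a pair of functions
  \<open>x y :: nat \<Rightarrow> real\<close> (coordinates of the bodies), similarly \<open>u v\<close> for the velocities; a motion
  carries time as the first argument. The coordinates \<open>(x, y)\<close> with \<open>\<kappa> (x\<^sup>2 + y\<^sup>2) < 1\<close> describe the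
  point of the sphere (\<open>\<kappa> > 0\<close>) or of the hyperbolic sheet (\<open>\<kappa> < 0\<close>) of curvature \<open>\<kappa>\<close> whose height
  is \<open>(sqrt (1 - \<kappa> (x\<^sup>2 + y\<^sup>2)) - 1) / sqrt \<bar>\<kappa>\<bar>\<close>.
\<close>

abbreviation bodies :: "nat set" where
  "bodies \<equiv> {1..4}"

definition A_term :: "(nat \<Rightarrow> real) \<Rightarrow> (nat \<Rightarrow> real) \<Rightarrow> nat \<Rightarrow> real" where
  "A_term x y i = (x i)\<^sup>2 + (y i)\<^sup>2"

definition B_term ::
  "real \<Rightarrow> (nat \<Rightarrow> real) \<Rightarrow> (nat \<Rightarrow> real) \<Rightarrow> (nat \<Rightarrow> real) \<Rightarrow> (nat \<Rightarrow> real) \<Rightarrow> nat \<Rightarrow> real" where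
  "B_term \<kappa> x y u v i = (x i * u i + y i * v i)\<^sup>2 / (1 - \<kappa> * ((x i)\<^sup>2 + (y i)\<^sup>2))"

definition rho :: "real \<Rightarrow> (nat \<Rightarrow> real) \<Rightarrow> (nat \<Rightarrow> real) \<Rightarrow> nat \<Rightarrow> nat \<Rightarrow> real" where
  "rho \<kappa> x y i j = sqrt ((x i - x j)\<^sup>2 + (y i - y j)\<^sup>2
     + \<kappa> * (A_term x y i - A_term x y j)\<^sup>2
         / (sqrt (1 - \<kappa> * A_term x y i) + sqrt (1 - \<kappa> * A_term x y j))\<^sup>2)"

text \<open>
  The common form of the right-hand sides of the two equations for body \<open>i\<close>; \<open>w\<close> is the coordinate
  concerned, i.e. \<open>w = x\<close> or \<open>w = y\<close>.
\<close>

definition acceleration ::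
  "real \<Rightarrow> (nat \<Rightarrow> real) \<Rightarrow> (nat \<Rightarrow> real) \<Rightarrow> (nat \<Rightarrow> real) \<Rightarrow> (nat \<Rightarrow> real) \<Rightarrow> (nat \<Rightarrow> real)
     \<Rightarrow> (nat \<Rightarrow> real) \<Rightarrow> nat \<Rightarrow> real" where
  "acceleration \<kappa> mass x y u v w i =
     (\<Sum>j\<in>bodies - {i}.
        mass j * (w j - (1 - \<kappa> * (rho \<kappa> x y i j)\<^sup>2 / 2) * w i)
          / ((1 - \<kappa> * (rho \<kappa> x y i j)\<^sup>2 / 4) powr (3/2) * (rho \<kappa> x y i j)^3))
     - \<kappa> * ((u i)\<^sup>2 + (v i)\<^sup>2 + \<kappa> * B_term \<kappa> x y u v i) * w i"

text \<open>
  The configurations at which the equations are regular: every body lies in the coordinate domain,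
  no two bodies collide, and no two are antipodal (which would require \<open>\<kappa> \<rho>\<^sup>2 = 4\<close>). Stating this
  keeps the total division and square root of HOL from giving values outside the domain.
\<close>

definition regular_configuration :: "real \<Rightarrow> (nat \<Rightarrow> real) \<Rightarrow> (nat \<Rightarrow> real) \<Rightarrow> bool" where
  "regular_configuration \<kappa> x y \<longleftrightarrow>
     (\<forall>i\<in>bodies. \<kappa> * ((x i)\<^sup>2 + (y i)\<^sup>2) < 1) \<and>
     (\<forall>i\<in>bodies. \<forall>j\<in>bodies. i \<noteq> j \<longrightarrow>
        rho \<kappa> x y i j > 0 \<and> 1 - \<kappa> * (rho \<kappa> x y i j)\<^sup>2 / 4 > 0)"

definition is_solution ::
  "real \<Rightarrow> (nat \<Rightarrow> real) \<Rightarrow> (real \<Rightarrow> nat \<Rightarrow> real) \<Rightarrow> (real \<Rightarrow> nat \<Rightarrow> real) \<Rightarrow> bool" where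
  "is_solution \<kappa> mass x y \<longleftrightarrow>
     (\<forall>t. regular_configuration \<kappa> (x t) (y t)) \<and>
     (\<exists>u v. \<forall>t. \<forall>i\<in>bodies.
        ((\<lambda>s. x s i) has_real_derivative u t i) (at t) \<and>
        ((\<lambda>s. y s i) has_real_derivative v t i) (at t) \<and>
        ((\<lambda>s. u s i) has_real_derivative
           acceleration \<kappa> mass (x t) (y t) (u t) (v t) (x t) i) (at t) \<and>
        ((\<lambda>s. v s i) has_real_derivative
           acceleration \<kappa> mass (x t) (y t) (u t) (v t) (y t) i) (at t))"

definition is_relative_equilibrium ::
  "real \<Rightarrow> (nat \<Rightarrow> real) \<Rightarrow> (real \<Rightarrow> nat \<Rightarrow> real) \<Rightarrow> (real \<Rightarrow> nat \<Rightarrow> real) \<Rightarrow> bool" where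
  "is_relative_equilibrium \<kappa> mass x y \<longleftrightarrow>
     is_solution \<kappa> mass x y \<and>
     (\<forall>i\<in>bodies. \<forall>j\<in>bodies. \<forall>s t. rho \<kappa> (x s) (y s) i j = rho \<kappa> (x t) (y t) i j)"

definition two_masses :: "real \<Rightarrow> nat \<Rightarrow> real" where
  "two_masses m i = (if i = 1 \<or> i = 2 then m else 0)"

text \<open>The last branch in each of the next two definitions is that of body \<open>4\<close>.\<close>

definition square_x :: "real \<Rightarrow> real \<Rightarrow> real \<Rightarrow> nat \<Rightarrow> real" where
  "square_x r \<alpha> t i =
     (if i = 1 then r * cos (\<alpha> * t)
      else if i = 2 then - r * cos (\<alpha> * t)
      else if i = 3 then - r * sin (\<alpha> * t)
      else r * sin (\<alpha> * t))"

definition square_y :: "real \<Rightarrow> real \<Rightarrow> real \<Rightarrow> nat \<Rightarrow> real" where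
  "square_y r \<alpha> t i =
     (if i = 1 then r * sin (\<alpha> * t)
      else if i = 2 then - r * sin (\<alpha> * t)
      else if i = 3 then r * cos (\<alpha> * t)
      else - r * cos (\<alpha> * t))"

end

theory Submission
  imports Defs
begin

text \<open>
  Write \<open>c = \<kappa> r\<^sup>2\<close>. Along the rotating square each coordinate \<open>w\<close> of a body satisfies
  \<open>w'' = -\<alpha>\<^sup>2 w\<close>, while the equations of motion give \<open>w'' = -((1 - c) q + c \<alpha>\<^sup>2) w\<close>, where
  \<open>q = m / (sqrt 2 r\<^sup>3 s\<^bsup>3/2\<^esup>)\<close> with \<open>s = 2 (1 - c)\<close> for the two heavy bodies and
  \<open>s = 1 - c / 2\<close> for the two negligible ones. Hence the square is a solution iff \<open>\<alpha>\<^sup>2 = q\<close> for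
  both values of \<open>s\<close>, which forces \<open>2 (1 - c) = 1 - c / 2\<close>, i.e. \<open>\<kappa> r\<^sup>2 = 2/3\<close>. This is attained
  inside the domain for \<open>\<kappa> > 0\<close> and is impossible for \<open>\<kappa> < 0\<close>.
\<close>

lemma bodies_eq: "bodies = {1, 2, 3, 4}"
  by auto

lemma square_x_has_derivative:
  "((\<lambda>s. square_x r \<alpha> s i) has_real_derivative - \<alpha> * square_y r \<alpha> t i) (at t)"
  unfolding square_x_def square_y_def
  by (cases "i = 1"; cases "i = 2"; cases "i = 3") (auto intro!: derivative_eq_intros)

lemma square_y_has_derivative:
  "((\<lambda>s. square_y r \<alpha> s i) has_real_derivative \<alpha> * square_x r \<alpha> t i) (at t)"
  unfolding square_x_def square_y_def
  by (cases "i = 1"; cases "i = 2"; cases "i = 3") (auto intro!: derivative_eq_intros)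

lemma square_norm: "(square_x r \<alpha> t i)\<^sup>2 + (square_y r \<alpha> t i)\<^sup>2 = r\<^sup>2"
proof -
  have "(r * cos (\<alpha> * t))\<^sup>2 + (r * sin (\<alpha> * t))\<^sup>2 = r\<^sup>2"
    by (simp add: power_mult_distrib flip: distrib_left)
  then show ?thesis
    by (auto simp: square_x_def square_y_def add.commute)
qed

text \<open>All bodies lie on one circle, so \<open>A_term\<close> is the same for both and the
  curvature term of \<open>rho\<close> vanishes. What is left is the Euclidean distance: a diagonal
  of the square for opposite bodies, a side otherwise.\<close>

lemma rho_square:
  assumes "r > 0" "i \<in> bodies" "j \<in> bodies" "i \<noteq> j"
  shows "rho \<kappa> (square_x r \<alpha> t) (square_y r \<alpha> t) i j =
    (if {i, j} = {1, 2} \<or> {i, j} = {3, 4} then 2 * r else sqrt 2 * r)"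
proof -
  define a b where "a = r * cos (\<alpha> * t)" and "b = r * sin (\<alpha> * t)"
  have ab: "a\<^sup>2 + b\<^sup>2 = r\<^sup>2"
    by (simp add: a_def b_def power_mult_distrib flip: distrib_left)
  \<comment> \<open>Once \<open>r\<^sup>2\<close> is replaced by
    \<open>a\<^sup>2 + b\<^sup>2\<close>, every pair of bodies gives a polynomial identity in
    \<open>a\<close> and \<open>b\<close>.\<close>
  have "(square_x r \<alpha> t i - square_x r \<alpha> t j)\<^sup>2 + (square_y r \<alpha> t i - square_y r \<alpha> t j)\<^sup>2 =
      (if {i, j} = {1, 2} \<or> {i, j} = {3, 4} then 4 * r\<^sup>2 else 2 * r\<^sup>2)"
    using assms(2-4) unfolding bodies_eq square_x_def square_y_def ab[symmetric]
      mult_minus_left a_def[symmetric] b_def[symmetric]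
    by (elim insertE emptyE) (simp_all add: doubleton_eq_iff power2_eq_square algebra_simps)
  then show ?thesis
    using \<open>r > 0\<close> by (simp add: rho_def A_term_def square_norm real_sqrt_mult)
qed

text \<open>With \<open>c = \<kappa> * r\<^sup>2\<close>, the quantity
  \<open>1 - \<kappa> * \<rho>\<^sup>2 / 4\<close> is \<open>1 - c\<close> on a diagonal and
  \<open>1 - c / 2\<close> on a side. Both are positive as soon as \<open>c < 1\<close>, so the
  coordinate domain already excludes antipodal pairs.\<close>

lemma regular_square_iff:
  assumes "r > 0"
  shows "regular_configuration \<kappa> (square_x r \<alpha> t) (square_y r \<alpha> t) \<longleftrightarrow> \<kappa> * r\<^sup>2 < 1"
proof -
  have "0 < rho \<kappa> (square_x r \<alpha> t) (square_y r \<alpha> t) i j \<and>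
      0 < 1 - \<kappa> * (rho \<kappa> (square_x r \<alpha> t) (square_y r \<alpha> t) i j)\<^sup>2 / 4"
    if "\<kappa> * r\<^sup>2 < 1" "i \<in> bodies" "j \<in> bodies" "i \<noteq> j" for i j
    unfolding rho_square[OF assms that(2-4)]
    using that(1) assms by (simp add: power_mult_distrib)
  moreover have "(1::nat) \<in> bodies"
    by simp
  ultimately show ?thesis
    unfolding regular_configuration_def square_norm by blast
qed

text \<open>The normalisation lets one function of \<open>s\<close> serve both kinds of bodies, so
  that comparing their rates amounts to comparing two values of \<open>s\<close>.\<close>

definition orbital_rate :: "real \<Rightarrow> real \<Rightarrow> real \<Rightarrow> real" where
  "orbital_rate m r s = m / (sqrt 2 * r^3 * s powr (3/2))"

lemma two_powr_three_halves: "(2::real) powr (3/2) = 2 * sqrt 2"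
proof -
  have "(2::real) powr (3/2) = 2 powr (1 + 1/2)"
    by simp
  also have "\<dots> = 2 * sqrt 2"
    unfolding powr_add by (simp add: powr_half_sqrt)
  finally show ?thesis .
qed

text \<open>Either coordinate may be taken for \<open>w\<close>, since only the antipodal symmetry
  of the two pairs is used. This symmetry makes the total force radial.\<close>

lemma acceleration_square:
  fixes \<kappa> m r \<alpha> t :: real
  assumes "r > 0" "\<kappa> * r\<^sup>2 < 1" "i \<in> bodies" and w: "w 2 = - w 1" "w 4 = - w 3"
  defines "x \<equiv> square_x r \<alpha> t" and "y \<equiv> square_y r \<alpha> t"
  shows "acceleration \<kappa> (two_masses m) x y (\<lambda>j. - \<alpha> * y j) (\<lambda>j. \<alpha> * x j) w i =
    - ((1 - \<kappa> * r\<^sup>2) *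
        orbital_rate m r (if i \<in> {1, 2} then 2 * (1 - \<kappa> * r\<^sup>2) else 1 - \<kappa> * r\<^sup>2 / 2)
       + \<kappa> * r\<^sup>2 * \<alpha>\<^sup>2) * w i"
proof -
  \<comment> \<open>The velocity is orthogonal to the position.\<close>
  have B: "B_term \<kappa> x y (\<lambda>j. - \<alpha> * y j) (\<lambda>j. \<alpha> * x j) i = 0"
    by (simp add: B_term_def)
  have speed: "(- \<alpha> * y i)\<^sup>2 + (\<alpha> * x i)\<^sup>2 = \<alpha>\<^sup>2 * r\<^sup>2"
    using square_norm[of r \<alpha> t i]
    by (simp add: x_def y_def power_mult_distrib add.commute flip: distrib_left)
  define c where "c = \<kappa> * r\<^sup>2"
  have pos: "1 - c > 0" "1 - c / 2 > 0"
    using assms(2) by (auto simp: c_def)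
  have R: "rho \<kappa> x y 1 2 = 2 * r" "rho \<kappa> x y 2 1 = 2 * r"
    "rho \<kappa> x y 3 1 = sqrt 2 * r" "rho \<kappa> x y 3 2 = sqrt 2 * r"
    "rho \<kappa> x y 4 1 = sqrt 2 * r" "rho \<kappa> x y 4 2 = sqrt 2 * r"
    by (simp_all add: x_def y_def rho_square assms(1) doubleton_eq_iff)
  have e: "\<kappa> * (2 * r)\<^sup>2 = 4 * c" "\<kappa> * (sqrt 2 * r)\<^sup>2 = 2 * c"
    by (simp_all add: c_def power_mult_distrib)
  have s3: "sqrt 2 ^ 3 = 2 * sqrt (2::real)"
    by (simp add: power3_eq_cube)
  \<comment> \<open>The factor 2 in the argument contributes \<open>2 * sqrt 2\<close>, which
    together with \<open>sqrt 2\<close> gives 4: the 8 from \<open>(2 * r)^3\<close> divided by the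
    2 in the numerator \<open>- 2 * (1 - c) * w i\<close>.\<close>
  have heavy: "orbital_rate m r (2 * (1 - c)) = m / (4 * r^3 * (1 - c) powr (3/2))"
    using pos unfolding orbital_rate_def
    by (subst powr_mult) (simp_all add: two_powr_three_halves)
  have S1: "(\<Sum>j\<in>bodies - {i}. two_masses m j * (w j - (1 - \<kappa> * (rho \<kappa> x y i j)\<^sup>2 / 2) * w i)
          / ((1 - \<kappa> * (rho \<kappa> x y i j)\<^sup>2 / 4) powr (3/2) * (rho \<kappa> x y i j)^3)) =
      - ((1 - c) * orbital_rate m r (2 * (1 - c))) * w i" if "i = 1 \<or> i = 2"
  proof -
    \<comment> \<open>The opposite heavy body, the only one that attracts \<open>i\<close>.\<close>
    define k where "k = 3 - i"
    have "i = 1 \<and> k = 2 \<or> i = 2 \<and> k = 1"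
      using that by (auto simp: k_def)
    then have k: "bodies - {i} = {k, 3, 4}" "k \<notin> {3, 4}" "two_masses m k = m"
      "w k = - w i" "rho \<kappa> x y i k = 2 * r"
      using R w by (auto simp: two_masses_def)
    have "(\<Sum>j\<in>bodies - {i}. two_masses m j * (w j - (1 - \<kappa> * (rho \<kappa> x y i j)\<^sup>2 / 2) * w i)
          / ((1 - \<kappa> * (rho \<kappa> x y i j)\<^sup>2 / 4) powr (3/2) * (rho \<kappa> x y i j)^3)) =
        m * (- w i - (1 - 2 * c) * w i) / ((1 - c) powr (3/2) * (2 * r)^3)"
      unfolding k(1) using k(2-) by (simp add: c_def power_mult_distrib two_masses_def)
    also have "\<dots> = - ((1 - c) * orbital_rate m r (2 * (1 - c))) * w i"
      unfolding heavy using pos assms(1) by (simp add: field_simps power_mult_distrib)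
    finally show ?thesis .
  qed
  have S3: "(\<Sum>j\<in>bodies - {i}. two_masses m j * (w j - (1 - \<kappa> * (rho \<kappa> x y i j)\<^sup>2 / 2) * w i)
          / ((1 - \<kappa> * (rho \<kappa> x y i j)\<^sup>2 / 4) powr (3/2) * (rho \<kappa> x y i j)^3)) =
      - ((1 - c) * orbital_rate m r (1 - c / 2)) * w i" if "i = 3 \<or> i = 4"
  proof -
    \<comment> \<open>The other negligible body, which exerts no force.\<close>
    define k where "k = 7 - i"
    have "i = 3 \<and> k = 4 \<or> i = 4 \<and> k = 3"
      using that by (auto simp: k_def)
    then have k: "bodies - {i} = {1, 2, k}" "k \<notin> {1, 2}" "two_masses m k = 0"
      "rho \<kappa> x y i 1 = sqrt 2 * r" "rho \<kappa> x y i 2 = sqrt 2 * r"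
      using R w by (auto simp: two_masses_def)
    have "(\<Sum>j\<in>bodies - {i}. two_masses m j * (w j - (1 - \<kappa> * (rho \<kappa> x y i j)\<^sup>2 / 2) * w i)
          / ((1 - \<kappa> * (rho \<kappa> x y i j)\<^sup>2 / 4) powr (3/2) * (rho \<kappa> x y i j)^3)) =
        m * (w 1 - (1 - c) * w i) / ((1 - c / 2) powr (3/2) * (sqrt 2 * r)^3) +
        m * (- w 1 - (1 - c) * w i) / ((1 - c / 2) powr (3/2) * (sqrt 2 * r)^3)"
      unfolding k(1) using k(2-) w by (subst sum.insert; simp add: e two_masses_def)
    \<comment> \<open>The heavy bodies are equidistant from \<open>i\<close> and opposite, so
      \<open>w 1\<close> cancels between the two terms.\<close>
    also have "\<dots> = - ((1 - c) * orbital_rate m r (1 - c / 2)) * w i"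
      unfolding orbital_rate_def add_divide_distrib[symmetric] power_mult_distrib s3
      using pos assms(1) by (simp add: field_simps)
    finally show ?thesis .
  qed
  have "i = 1 \<or> i = 2 \<or> i = 3 \<or> i = 4"
    using assms(3) unfolding bodies_eq by auto
  then show ?thesis
    unfolding acceleration_def B speed c_def[symmetric]
    using S1 S3 by (auto simp: c_def algebra_simps)
qed

lemma is_solution_square_iff:
  assumes "r > 0"
  shows "is_solution \<kappa> (two_masses m) (square_x r \<alpha>) (square_y r \<alpha>) \<longleftrightarrow>
    \<kappa> * r\<^sup>2 < 1 \<and> \<alpha>\<^sup>2 = orbital_rate m r (2 * (1 - \<kappa> * r\<^sup>2)) \<and>
    \<alpha>\<^sup>2 = orbital_rate m r (1 - \<kappa> * r\<^sup>2 / 2)"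
    (is "?sol \<longleftrightarrow> ?c < 1 \<and> _ = ?q1 \<and> _ = ?q3")
proof -
  let ?x = "square_x r \<alpha>" and ?y = "square_y r \<alpha>"
  let ?q = "\<lambda>i::nat. orbital_rate m r (if i \<in> {1, 2} then 2 * (1 - ?c) else 1 - ?c / 2)"
  define acc where "acc w t i = acceleration \<kappa> (two_masses m) (?x t) (?y t)
    (\<lambda>j. - \<alpha> * ?y t j) (\<lambda>j. \<alpha> * ?x t j) w i" for w t i
  have antipodal: "?x t 2 = - ?x t 1" "?x t 4 = - ?x t 3" "?y t 2 = - ?y t 1" "?y t 4 = - ?y t 3"
    for t by (simp_all add: square_x_def square_y_def)
  have acc_x: "acc (?x t) t i = - ((1 - ?c) * ?q i + ?c * \<alpha>\<^sup>2) * ?x t i"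
    and acc_y: "acc (?y t) t i = - ((1 - ?c) * ?q i + ?c * \<alpha>\<^sup>2) * ?y t i"
    if "?c < 1" "i \<in> bodies" for t i
    unfolding acc_def
    by (rule acceleration_square[OF assms that]; simp add: antipodal[simplified])+
  have D2x: "((\<lambda>s. - \<alpha> * ?y s i) has_real_derivative - \<alpha>\<^sup>2 * ?x t i) (at t)"
    and D2y: "((\<lambda>s. \<alpha> * ?x s i) has_real_derivative - \<alpha>\<^sup>2 * ?y t i) (at t)" for i t
    by (auto intro!: derivative_eq_intros square_x_has_derivative square_y_has_derivative
        simp: power2_eq_square)
  show ?thesis
  proof
    assume sol: ?sol
    then have c: "?c < 1"
      unfolding is_solution_def regular_square_iff[OF assms] by blast
    from sol obtain u v where D: "\<And>t i. i \<in> bodies \<Longrightarrow>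
        ((\<lambda>s. ?x s i) has_real_derivative u t i) (at t) \<and>
        ((\<lambda>s. ?y s i) has_real_derivative v t i) (at t) \<and>
        ((\<lambda>s. u s i) has_real_derivative
           acceleration \<kappa> (two_masses m) (?x t) (?y t) (u t) (v t) (?x t) i) (at t) \<and>
        ((\<lambda>s. v s i) has_real_derivative
           acceleration \<kappa> (two_masses m) (?x t) (?y t) (u t) (v t) (?y t) i) (at t)"
      unfolding is_solution_def by blast
    \<comment> \<open>A solution merely asserts that some velocities exist; uniqueness of
      derivatives identifies them.\<close>
    have u: "u t i = - \<alpha> * ?y t i" and v: "v t i = \<alpha> * ?x t i" if "i \<in> bodies" for t i
      using D[OF that] square_x_has_derivative square_y_has_derivative DERIV_unique by blast+
    \<comment> \<open>The velocities are known only at indices in \<open>bodies\<close>, which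
      suffices because the acceleration of \<open>i\<close> involves them only at
      \<open>i\<close>.\<close>
    have acc: "acceleration \<kappa> (two_masses m) (?x t) (?y t) (u t) (v t) w i = acc w t i"
      if "i \<in> bodies" for t w i
      by (simp add: acceleration_def B_term_def acc_def u[OF that] v[OF that])
    have "acc (?x t) t i = - \<alpha>\<^sup>2 * ?x t i" "acc (?y t) t i = - \<alpha>\<^sup>2 * ?y t i"
      if "i \<in> bodies" for t i
      using D[OF that, of t] D2x[of i t] D2y[of i t] DERIV_unique
      unfolding u[OF that] v[OF that] acc[OF that] by blast+
    \<comment> \<open>One body of each kind is enough, taken at time 0 in the coordinate where it
      equals \<open>r\<close>, so that this factor can be cancelled.\<close>
    then have "- ((1 - ?c) * ?q 1 + ?c * \<alpha>\<^sup>2) * ?x 0 1 = - \<alpha>\<^sup>2 * ?x 0 1"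
      "- ((1 - ?c) * ?q 3 + ?c * \<alpha>\<^sup>2) * ?y 0 3 = - \<alpha>\<^sup>2 * ?y 0 3"
      using acc_x[OF c, of 1 0] acc_y[OF c, of 3 0] by fastforce+
    moreover have "?x 0 1 = r" "?y 0 3 = r" "?q 1 = ?q1" "?q 3 = ?q3"
      by (simp_all add: square_x_def square_y_def)
    ultimately have "(1 - ?c) * ?q1 + ?c * \<alpha>\<^sup>2 = \<alpha>\<^sup>2" "(1 - ?c) * ?q3 + ?c * \<alpha>\<^sup>2 = \<alpha>\<^sup>2"
      using assms by (simp_all only: mult_minus_left neg_equal_iff_equal mult_cancel_right) simp_all
    \<comment> \<open>The centripetal term \<open>?c * \<alpha>\<^sup>2\<close> moves to the other
      side; the common factor \<open>1 - ?c\<close> is positive and cancels.\<close>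
    then have "(1 - ?c) * ?q1 = (1 - ?c) * \<alpha>\<^sup>2" "(1 - ?c) * ?q3 = (1 - ?c) * \<alpha>\<^sup>2"
      by argo+
    with c show "?c < 1 \<and> \<alpha>\<^sup>2 = ?q1 \<and> \<alpha>\<^sup>2 = ?q3"
      by simp
  next
    assume *: "?c < 1 \<and> \<alpha>\<^sup>2 = ?q1 \<and> \<alpha>\<^sup>2 = ?q3"
    then have q: "?q i = \<alpha>\<^sup>2" for i
      by simp
    have "acc (?x t) t i = - \<alpha>\<^sup>2 * ?x t i" "acc (?y t) t i = - \<alpha>\<^sup>2 * ?y t i"
      if "i \<in> bodies" for t i
      using * that by (simp_all only: acc_x acc_y q) (simp_all add: algebra_simps)
    then show ?sol
      using * D2x D2y square_x_has_derivative square_y_has_derivative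
      unfolding is_solution_def regular_square_iff[OF assms] acc_def
      by (intro conjI exI[of _ "\<lambda>t i. - \<alpha> * ?y t i"] exI[of _ "\<lambda>t i. \<alpha> * ?x t i"]) simp_all
  qed
qed

text \<open>The power 3/2 is strictly increasing on positive arguments.\<close>

lemma orbital_rate_eq_iff:
  assumes "m > 0" "r > 0" "s > 0" "s' > 0"
  shows "orbital_rate m r s = orbital_rate m r s' \<longleftrightarrow> s = s'"
proof -
  have "orbital_rate m r s = orbital_rate m r s' \<longleftrightarrow> s powr (3/2) = s' powr (3/2)"
    using assms by (auto simp: orbital_rate_def field_simps)
  also have "\<dots> \<longleftrightarrow> s = s'"
    using assms powr_less_mono2[of "3/2" s s'] powr_less_mono2[of "3/2" s' s]
    by (cases s s' rule: linorder_cases) auto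
  finally show ?thesis .
qed

theorem theorem2:
  fixes \<kappa> m :: real
  assumes "m > 0" and "\<kappa> \<noteq> 0"
  shows "(\<kappa> > 0 \<longrightarrow>
            (\<exists>r \<alpha>. 0 < r \<and> r < \<kappa> powr (-1/2) \<and> \<alpha> \<noteq> 0 \<and>
               is_relative_equilibrium \<kappa> (two_masses m) (square_x r \<alpha>) (square_y r \<alpha>)))
       \<and> (\<kappa> < 0 \<longrightarrow>
            (\<forall>r \<alpha>. r > 0 \<and> \<alpha> \<noteq> 0 \<longrightarrow>
               \<not> is_solution \<kappa> (two_masses m) (square_x r \<alpha>) (square_y r \<alpha>)))"
proof (intro conjI impI allI)
  assume \<kappa>: "\<kappa> > 0"
  \<comment> \<open>Chosen so that \<open>\<kappa> * r\<^sup>2 = 2/3\<close>, where both arguments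
    of \<open>orbital_rate\<close> equal 2/3; the common rate is then taken as
    \<open>\<alpha>\<^sup>2\<close>.\<close>
  define r where "r = sqrt (2 / (3 * \<kappa>))"
  define \<alpha> where "\<alpha> = sqrt (orbital_rate m r (2/3))"
  have r: "r > 0" and c: "\<kappa> * r\<^sup>2 = 2/3"
    using \<kappa> by (simp_all add: r_def)
  have "r < sqrt (1 / \<kappa>)"
    unfolding r_def using \<kappa> by (simp add: field_simps)
  also have "\<dots> = \<kappa> powr (-1/2)"
    using \<kappa> by (simp add: powr_minus_divide powr_half_sqrt real_sqrt_divide)
  finally have r_less: "r < \<kappa> powr (-1/2)" .
  have pos: "orbital_rate m r (2/3) > 0"
    using assms r by (simp add: orbital_rate_def)
  then have "is_solution \<kappa> (two_masses m) (square_x r \<alpha>) (square_y r \<alpha>)"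
    unfolding is_solution_square_iff[OF r] c by (simp add: \<alpha>_def)
  moreover have "rho \<kappa> (square_x r \<alpha> s) (square_y r \<alpha> s) i j =
      rho \<kappa> (square_x r \<alpha> t) (square_y r \<alpha> t) i j" if "i \<in> bodies" "j \<in> bodies" for s t i j
  proof (cases "i = j")
    case True
    then show ?thesis by (simp add: rho_def)
  next
    case False
    then show ?thesis using rho_square[OF r that] by simp
  qed
  ultimately have "is_relative_equilibrium \<kappa> (two_masses m) (square_x r \<alpha>) (square_y r \<alpha>)"
    unfolding is_relative_equilibrium_def by blast
  moreover have "\<alpha> \<noteq> 0"
    using pos by (simp add: \<alpha>_def)
  ultimately show "\<exists>r \<alpha>. 0 < r \<and> r < \<kappa> powr (-1/2) \<and> \<alpha> \<noteq> 0 \<and>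
      is_relative_equilibrium \<kappa> (two_masses m) (square_x r \<alpha>) (square_y r \<alpha>)"
    using r r_less by blast
next
  fix r \<alpha> :: real
  assume \<kappa>: "\<kappa> < 0" and "r > 0 \<and> \<alpha> \<noteq> 0"
  then have r: "r > 0" by simp
  have c: "\<kappa> * r\<^sup>2 < 0"
    using \<kappa> r by (simp add: mult_neg_pos)
  show "\<not> is_solution \<kappa> (two_masses m) (square_x r \<alpha>) (square_y r \<alpha>)"
  proof
    assume "is_solution \<kappa> (two_masses m) (square_x r \<alpha>) (square_y r \<alpha>)"
    then have "orbital_rate m r (2 * (1 - \<kappa> * r\<^sup>2)) = orbital_rate m r (1 - \<kappa> * r\<^sup>2 / 2)"
      unfolding is_solution_square_iff[OF r] by simp
    \<comment> \<open>Negativity of \<open>\<kappa> * r\<^sup>2\<close> makes both arguments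
      positive, so injectivity applies; their equality would force
      \<open>\<kappa> * r\<^sup>2 = 2/3\<close>.\<close>
    then have "2 * (1 - \<kappa> * r\<^sup>2) = 1 - \<kappa> * r\<^sup>2 / 2"
      using orbital_rate_eq_iff[OF assms(1) r] c by simp
    with c show False by simp
  qed
qed

end
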